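(* Let $w=\prod_{v=1}^m x_{i_v}^{\epsilon_v}$ (with $\epsilon_v\in\{1,-1\}$) be a word in the letters $x_1^{\pm1},\dots,x_n^{\pm1}$. For any $i\neq j\in\{1,\dots,n\}$, $$e_{ij}(w)=\oint_{\gamma_{ij}(w)}x\,dy .$$ Additionally, if $\gamma_{ij}(w)$ is a simple closed curve with counterclockwise orientation, then $e_{ij}(w)$ is the area enclosed by $\gamma_{ij}(w)$.
   Context: Words are not reduced. For a word $w=\prod_{v=1}^m x_{i_v}^{\epsilon_v}$ and $i\neq j$, $$e_{ij}(w)=\sum_{v=1}^m\sum_{u=1}^v\delta(i_u,i)\,\delta(i_v,j)\,\epsilon_u\epsilon_v,$$ where $\delta$ is the Kronecker delta. The curve $\gamma_{ij}(w)$ is the piecewise linear oriented curve in $\mathbb{R}^2$ built as follows: start at $(0,0)$ and read $w$ from left to right; for each letter $x_i$ travel right a length of $1$, for each $x_i^{-1}$ travel left a length of $1$, for each $x_j$ travel up a length of $1$, for each $x_j^{-1}$ travel down a length of $1$; all other letters contribute no movement. The symbol $\oint$ denotes the line integral along this oriented curve, which is not assumed closed in the first assertion. *)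

theory Defs
  imports "HOL-Complex_Analysis.Complex_Analysis"
begin

text \<open>A letter \<open>x\<^sub>k\<^sup>\<epsilon>\<close> is the pair \<open>(k, \<epsilon>)\<close>. Words are plain lists:
  cancelling pairs are kept, since words are not reduced.\<close>

type_synonym word = "(nat \<times> int) list"

definition is_word :: "nat \<Rightarrow> word \<Rightarrow> bool" where
  "is_word n w \<longleftrightarrow> (\<forall>(k, \<epsilon>) \<in> set w. k \<in> {1..n} \<and> \<epsilon> \<in> {1, -1})"

definition letter_index :: "word \<Rightarrow> nat \<Rightarrow> nat" where
  "letter_index w v = fst (w ! (v - 1))"

definition letter_sign :: "word \<Rightarrow> nat \<Rightarrow> int" where
  "letter_sign w v = snd (w ! (v - 1))"

definition kronecker :: "nat \<Rightarrow> nat \<Rightarrow> int" where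
  "kronecker a b = (if a = b then 1 else 0)"

definition e :: "nat \<Rightarrow> nat \<Rightarrow> word \<Rightarrow> int" where
  "e i j w = (\<Sum>v = 1..length w. \<Sum>u = 1..v.
     kronecker (letter_index w u) i * kronecker (letter_index w v) j *
     letter_sign w u * letter_sign w v)"

text \<open>The plane \<open>\<real>\<^sup>2\<close> is the type \<^typ>\<open>complex\<close>, with coordinates \<open>x = Re z\<close>, \<open>y = Im z\<close>.\<close>

definition letter_move :: "nat \<Rightarrow> nat \<times> int \<Rightarrow> complex" where
  "letter_move i = (\<lambda>(k, \<epsilon>). if k = i then Complex (of_int \<epsilon>) 0 else Complex 0 (of_int \<epsilon>))"

text \<open>The polygonal path from \<open>p\<close> with the given successive displacements. The singleton case
  is separate so that no constant piece is appended at the end: such a piece would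
  prevent the parametrised path from ever being a \<^const>\<open>simple_path\<close>.\<close>

fun polygonal_path :: "complex \<Rightarrow> complex list \<Rightarrow> (real \<Rightarrow> complex)" where
  "polygonal_path p [] = linepath p p"
| "polygonal_path p [d] = linepath p (p + d)"
| "polygonal_path p (d # d' # ds) = linepath p (p + d) +++ polygonal_path (p + d) (d' # ds)"

text \<open>Letters other than \<open>x\<^sub>i\<close>, \<open>x\<^sub>j\<close> are dropped rather than traversed as
  constant pieces, for the same reason.\<close>

definition curve :: "nat \<Rightarrow> nat \<Rightarrow> word \<Rightarrow> (real \<Rightarrow> complex)" where
  "curve i j w = polygonal_path 0 (map (letter_move i) (filter (\<lambda>l. fst l \<in> {i, j}) w))"

text \<open>The line integral of the form \<open>P dx + Q dy\<close> along \<open>g\<close> exists and equals \<open>I\<close>. As for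
  \<^const>\<open>has_contour_integral\<close>, finitely many corners of \<open>g\<close> are irrelevant.\<close>

definition has_line_integral ::
  "(complex \<Rightarrow> real) \<Rightarrow> (complex \<Rightarrow> real) \<Rightarrow> real \<Rightarrow> (real \<Rightarrow> complex) \<Rightarrow> bool" where
  "has_line_integral P Q I g \<longleftrightarrow>
     ((\<lambda>t. P (g t) * Re (vector_derivative g (at t within {0..1})) +
           Q (g t) * Im (vector_derivative g (at t within {0..1}))) has_integral I) {0..1}"

definition simple_closed_curve :: "(real \<Rightarrow> complex) \<Rightarrow> bool" where
  "simple_closed_curve g \<longleftrightarrow> simple_path g \<and> pathfinish g = pathstart g"

text \<open>For a simple closed curve the winding number is constantly \<open>1\<close> or constantly \<open>-1\<close>
  on the (nonempty) inside.\<close>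

definition counterclockwise :: "(real \<Rightarrow> complex) \<Rightarrow> bool" where
  "counterclockwise g \<longleftrightarrow> (\<forall>z \<in> inside (path_image g). winding_number g z = 1)"

definition enclosed_area :: "(real \<Rightarrow> complex) \<Rightarrow> real" where
  "enclosed_area g = measure lebesgue (inside (path_image g))"

end

theory Submission
  imports Defs
begin

text \<open>The enclosed area is the integral over the plane of the winding number of the curve. For a
  closed lattice polygon and a point \<open>z\<close> off the integer grid, joining each vertical edge to the
  \<open>y\<close>-axis by horizontal segments writes this winding number as a signed count of the rectangles,
  between the edges and the \<open>y\<close>-axis, that contain \<open>z\<close>: all other contributions telescope. The
  rectangle of an edge at abscissa \<open>x\<close> with vertical displacement \<open>h\<close> has signed area \<open>x h\<close>, which
  is also the integral of \<open>x dy\<close> along the edge.\<close>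

subsection \<open>Winding numbers of horizontal and vertical segments\<close>

text \<open>The sign records the orientation of the interval: the integral over \<open>t\<close> is
  \<open>b - a\<close> in either order of the endpoints, so products of two such factors integrate
  to signed rectangle areas.\<close>

definition between_sign :: "real \<Rightarrow> real \<Rightarrow> real \<Rightarrow> real" where
  "between_sign a b t = (if a < t \<and> t < b then 1 else if b < t \<and> t < a then - 1 else 0)"

lemma between_sign_swap: "between_sign b a t = - between_sign a b t"
  by (auto simp: between_sign_def)

lemma between_sign_same [simp]: "between_sign a a t = 0"
  by (auto simp: between_sign_def)

abbreviation segment_winding :: "complex \<Rightarrow> complex \<Rightarrow> complex \<Rightarrow> complex" where
  "segment_winding z p q \<equiv> winding_number (linepath p q) z"

lemma segment_winding_swap:
  assumes "z \<notin> closed_segment p q"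
  shows "segment_winding z q p = - segment_winding z p q"
  using winding_number_reversepath[of "linepath p q" z] assms by simp

text \<open>The closed path through \<open>p\<close>, \<open>q\<close>, \<open>r\<close> stays in a
  convex set that misses \<open>z\<close>, so its winding number is 0. With \<open>S\<close> a line
  this gives additivity along the line, in whatever order the points lie.\<close>

lemma segment_winding_collinear:
  assumes "convex S" "p \<in> S" "q \<in> S" "r \<in> S" "z \<notin> S"
  shows "segment_winding z p q + segment_winding z q r = segment_winding z p r"
proof -
  have sub: "closed_segment a b \<subseteq> S" if "a \<in> S" "b \<in> S" for a b
    using that assms(1) by (simp add: closed_segment_subset)
  have "winding_number (linepath p q +++ linepath q r +++ linepath r p) z = 0"
    by (rule winding_number_zero_outside[OF _ assms(1)])
       (use assms sub in \<open>auto simp: path_image_join\<close>)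
  moreover have "winding_number (linepath p q +++ linepath q r +++ linepath r p) z =
      segment_winding z p q + (segment_winding z q r + segment_winding z r p)"
    using assms sub by (subst winding_number_join winding_number_join; auto simp: path_image_join)+
  moreover have "segment_winding z r p = - segment_winding z p r"
    using segment_winding_swap[of z p r] sub assms by blast
  ultimately show ?thesis by (metis add.assoc add_eq_0_iff minus_minus add.commute)
qed

lemma convex_horizontal_line: "convex {z. Im z = c}"
  using convex_hyperplane[of \<i> c] by simp

lemma convex_vertical_line: "convex {z. Re z = c}"
  using convex_hyperplane[of "1::complex" c] by simp

lemma notin_horizontal_segment:
  assumes "Im p = c" "Im q = c" "Im z \<noteq> c"
  shows "z \<notin> closed_segment p q"
  using closed_segment_subset[OF _ _ convex_horizontal_line, of p c q] assms by auto

lemma notin_vertical_segment: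
  assumes "Re p = c" "Re q = c" "Re z \<noteq> c"
  shows "z \<notin> closed_segment p q"
  using closed_segment_subset[OF _ _ convex_vertical_line, of p c q] assms by auto

text \<open>The sides come in the order of \<open>rectpath\<close>, but as a sum of four terms,
  which also makes sense for reversed or degenerate rectangles.\<close>

definition boundary_winding :: "complex \<Rightarrow> real \<Rightarrow> real \<Rightarrow> real \<Rightarrow> real \<Rightarrow> complex" where
  "boundary_winding z a b c d =
     segment_winding z (Complex a c) (Complex b c) + segment_winding z (Complex b c) (Complex b d) +
     segment_winding z (Complex b d) (Complex a d) + segment_winding z (Complex a d) (Complex a c)"

lemma boundary_winding_swap:
  assumes "Re z \<noteq> a" "Re z \<noteq> b" "Im z \<noteq> c" "Im z \<noteq> d"
  shows "boundary_winding z b a c d = - boundary_winding z a b c d"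
    and "boundary_winding z a b d c = - boundary_winding z a b c d"
proof -
  have h: "segment_winding z (Complex s y) (Complex t y) = - segment_winding z (Complex t y) (Complex s y)"
    if "y \<in> {c, d}" for s t y
    using that assms by (intro segment_winding_swap notin_horizontal_segment[where c=y]) auto
  have v: "segment_winding z (Complex x s) (Complex x t) = - segment_winding z (Complex x t) (Complex x s)"
    if "x \<in> {a, b}" for s t x
    using that assms by (intro segment_winding_swap notin_vertical_segment[where c=x]) auto
  show "boundary_winding z b a c d = - boundary_winding z a b c d"
    unfolding boundary_winding_def
    using h[of c a b] h[of d a b] v[of a c d] v[of b c d] by simp
  show "boundary_winding z a b d c = - boundary_winding z a b c d"
    unfolding boundary_winding_def
    using h[of c a b] h[of d a b] v[of a c d] v[of b c d] by simp
qed

lemma boundary_winding_less: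
  assumes "a < b" "c < d" and off: "Re z \<noteq> a" "Re z \<noteq> b" "Im z \<noteq> c" "Im z \<noteq> d"
  shows "boundary_winding z a b c d = of_real (between_sign a b (Re z) * between_sign c d (Im z))"
proof -
  have "z \<notin> closed_segment (Complex a c) (Complex b c)" "z \<notin> closed_segment (Complex b c) (Complex b d)"
    "z \<notin> closed_segment (Complex b d) (Complex a d)" "z \<notin> closed_segment (Complex a d) (Complex a c)"
    using off notin_horizontal_segment[of _ c _ z] notin_horizontal_segment[of _ d _ z]
      notin_vertical_segment[of _ a _ z] notin_vertical_segment[of _ b _ z] by auto
  then have "winding_number (rectpath (Complex a c) (Complex b d)) z = boundary_winding z a b c d"
    unfolding rectpath_def boundary_winding_def Let_def
    by (simp add: winding_number_join path_image_join)
  moreover have "winding_number (rectpath (Complex a c) (Complex b d)) z =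
      of_real (between_sign a b (Re z) * between_sign c d (Im z))"
  proof (cases "z \<in> box (Complex a c) (Complex b d)")
    case True
    then show ?thesis
      by (subst winding_number_rectpath) (auto simp: between_sign_def in_box_complex_iff)
  next
    case False
    \<comment> \<open>Since \<open>z\<close> avoids the lines through the four sides, leaving the
      open box means leaving the closed one.\<close>
    then have "z \<notin> cbox (Complex a c) (Complex b d)"
      using off by (auto simp: in_box_complex_iff in_cbox_complex_iff)
    then show ?thesis
      using False assms
      by (subst winding_number_rectpath_outside) (auto simp: between_sign_def in_box_complex_iff)
  qed
  ultimately show ?thesis by simp
qed

lemma boundary_winding_eq:
  assumes off: "Re z \<noteq> a" "Re z \<noteq> b" "Im z \<noteq> c" "Im z \<noteq> d"
  shows "boundary_winding z a b c d = of_real (between_sign a b (Re z) * between_sign c d (Im z))"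
proof -
  have ordered: "boundary_winding z a b c d = of_real (between_sign a b (Re z) * between_sign c d (Im z))"
    if "a < b" "Re z \<noteq> a" "Re z \<noteq> b" for a b
  proof -
    consider "c < d" | "d < c" | "c = d" by linarith
    then show ?thesis
    proof cases
      case 1
      then show ?thesis using boundary_winding_less that off by simp
    next
      case 2
      then show ?thesis
        using boundary_winding_less[of a b d c z] boundary_winding_swap(2)[of z a b d c]
          between_sign_swap[of c d "Im z"] that off by simp
    next
      case 3
      \<comment> \<open>Swapping equal ordinates changes nothing, so the value equals its own
        negative.\<close>
      then show ?thesis using boundary_winding_swap(2)[of z a b c c] that off by simp
    qed
  qed
  consider "a < b" | "b < a" | "a = b" by linarith
  then show ?thesis
  proof cases
    case 1
    then show ?thesis using ordered off by simp
  next
    case 2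
    then show ?thesis
      using ordered[of b a] boundary_winding_swap(1)[of z b a c d]
        between_sign_swap[of a b "Re z"] off by simp
  next
    case 3
    then show ?thesis using boundary_winding_swap(1)[of z a a c d] off by simp
  qed
qed

subsection \<open>Polygonal paths on the integer grid\<close>

text \<open>A null set containing all lattice paths considered here, the \<open>y\<close>-axis and
  the connecting horizontals: off it no segment passes through \<open>z\<close>, and ignoring it
  does not affect the area.\<close>

definition integer_grid :: "complex set" where
  "integer_grid = {z. Re z \<in> \<int> \<or> Im z \<in> \<int>}"

definition lattice_point :: "complex \<Rightarrow> bool" where
  "lattice_point p \<longleftrightarrow> Re p \<in> \<int> \<and> Im p \<in> \<int>"

definition lattice_step :: "complex \<Rightarrow> bool" where
  "lattice_step d \<longleftrightarrow> lattice_point d \<and> (Re d = 0 \<or> Im d = 0)"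

lemma lattice_point_add: "lattice_point p \<Longrightarrow> lattice_step d \<Longrightarrow> lattice_point (p + d)"
  by (simp add: lattice_point_def lattice_step_def)

text \<open>The winding about \<open>z\<close> of the path from \<open>0\<close> to \<open>p\<close> that runs first along the \<open>y\<close>-axis and
  then horizontally; it is the potential that telescopes.\<close>

definition axis_winding :: "complex \<Rightarrow> complex \<Rightarrow> complex" where
  "axis_winding z p =
     segment_winding z 0 (Complex 0 (Im p)) + segment_winding z (Complex 0 (Im p)) p"

lemma off_grid_neq:
  assumes "lattice_point p" "z \<notin> integer_grid"
  shows "Re z \<noteq> Re p" "Im z \<noteq> Im p"
  using assms by (auto simp: integer_grid_def lattice_point_def)

lemma segment_notin_grid:
  assumes "lattice_point p" "lattice_step d" "z \<notin> integer_grid"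
  shows "z \<notin> closed_segment p (p + d)"
proof (cases "Re d = 0")
  case True
  then show ?thesis
    using notin_vertical_segment[of p "Re p" "p + d" z] off_grid_neq[of p z] assms by simp
next
  case False
  then show ?thesis
    using notin_horizontal_segment[of p "Im p" "p + d" z] off_grid_neq[of p z] assms
    by (simp add: lattice_step_def)
qed

text \<open>A horizontal step only extends the horizontal part of the potential. For a vertical
  step, the change of potential accounts for the other three sides of the rectangle between the edge
  and the \<open>y\<close>-axis, leaving the winding of its boundary.\<close>

lemma segment_winding_step:
  assumes p: "lattice_point p" and d: "lattice_step d" and z: "z \<notin> integer_grid"
  shows "segment_winding z p (p + d) = axis_winding z (p + d) - axis_winding z p +
    of_real (between_sign 0 (Re p) (Re z) * between_sign (Im p) (Im (p + d)) (Im z))"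
proof (cases "Im d = 0")
  case True
  then show ?thesis
    using segment_winding_collinear[OF convex_horizontal_line, of "Complex 0 (Im p)" "Im p" p "p + d" z] off_grid_neq[OF p z]
    by (simp add: axis_winding_def algebra_simps)
next
  case False
  then have re: "Re d = 0" using d by (simp add: lattice_step_def)
  define x y y' where "x = Re p" and "y = Im p" and "y' = Im (p + d)"
  have eqs: "p = Complex x y" "p + d = Complex x y'"
    using re by (simp_all add: x_def y_def y'_def complex_eq_iff)
  have "x \<in> \<int>" "y \<in> \<int>" "y' \<in> \<int>"
    using p d by (simp_all add: lattice_point_def lattice_step_def x_def y_def y'_def)
  then have off: "Re z \<noteq> 0" "Re z \<noteq> x" "Im z \<noteq> y" "Im z \<noteq> y'"
    using z by (auto simp: integer_grid_def)
  \<comment> \<open>The two potentials differ along the \<open>y\<close>-axis exactly by the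
    rectangle side from \<open>y\<close> to \<open>y'\<close>.\<close>
  have "segment_winding z 0 (Complex 0 y) + segment_winding z (Complex 0 y) (Complex 0 y') =
      segment_winding z 0 (Complex 0 y')"
    using segment_winding_collinear[OF convex_vertical_line, of 0 0 "Complex 0 y" "Complex 0 y'" z] off
    by simp
  moreover have "segment_winding z (Complex 0 y') (Complex 0 y) = - segment_winding z (Complex 0 y) (Complex 0 y')"
    using off by (intro segment_winding_swap notin_vertical_segment[where c=0]) auto
  moreover have "segment_winding z (Complex x y') (Complex 0 y') = - segment_winding z (Complex 0 y') (Complex x y')"
    using off by (intro segment_winding_swap notin_horizontal_segment[where c=y']) auto
  ultimately have "segment_winding z (Complex x y) (Complex x y') =
      axis_winding z (Complex x y') - axis_winding z (Complex x y) + boundary_winding z 0 x y y'"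
    by (simp add: axis_winding_def boundary_winding_def algebra_simps)
  then show ?thesis
    unfolding boundary_winding_eq[OF off] eqs(2) unfolding eqs(1) by (simp only: complex.sel)
qed

lemma polygonal_path_path [simp]:
  "path (polygonal_path p ds)" "pathstart (polygonal_path p ds) = p"
  "pathfinish (polygonal_path p ds) = p + sum_list ds"
  by (induction p ds rule: polygonal_path.induct) (auto simp: add.assoc)

fun crossing_sum :: "complex \<Rightarrow> complex \<Rightarrow> complex list \<Rightarrow> real" where
  "crossing_sum z p [] = 0"
| "crossing_sum z p (d # ds) =
     between_sign 0 (Re p) (Re z) * between_sign (Im p) (Im (p + d)) (Im z) + crossing_sum z (p + d) ds"

lemma polygonal_path_off_grid:
  assumes "lattice_point p" "list_all lattice_step ds" "z \<notin> integer_grid"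
  shows "z \<notin> path_image (polygonal_path p ds)"
  using assms
proof (induction p ds rule: polygonal_path.induct)
  case (1 p)
  then show ?case using off_grid_neq[of p z] by auto
next
  case (2 p d)
  then show ?case using segment_notin_grid by simp
next
  case (3 p d d' ds)
  then show ?case
    using segment_notin_grid[of p d z] lattice_point_add[of p d] by (simp add: path_image_join)
qed

text \<open>Summing \<open>segment_winding_step\<close> along the path telescopes the potential; for
  a closed path only \<open>crossing_sum\<close> survives.\<close>

lemma winding_number_polygonal_path:
  assumes "lattice_point p" "list_all lattice_step ds" "z \<notin> integer_grid"
  shows "winding_number (polygonal_path p ds) z =
    axis_winding z (p + sum_list ds) - axis_winding z p + of_real (crossing_sum z p ds)"
  using assms
proof (induction p ds rule: polygonal_path.induct)
  case (1 p)
  then have "segment_winding z p p = 0"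
    using off_grid_neq by (intro winding_number_trivial) blast
  then show ?case
    by (simp only: polygonal_path.simps sum_list.Nil crossing_sum.simps of_real_0 add_0_right diff_self)
next
  case (2 p d)
  then show ?case by (simp add: segment_winding_step)
next
  case (3 p d d' ds)
  have "winding_number (polygonal_path p (d # d' # ds)) z =
      segment_winding z p (p + d) + winding_number (polygonal_path (p + d) (d' # ds)) z"
    using 3 segment_notin_grid polygonal_path_off_grid[of "p + d" "d' # ds" z] lattice_point_add
    by (simp add: winding_number_join)
  also have "winding_number (polygonal_path (p + d) (d' # ds)) z =
      axis_winding z (p + d + sum_list (d' # ds)) - axis_winding z (p + d) +
      of_real (crossing_sum z (p + d) (d' # ds))"
    using 3 lattice_point_add by simp
  also have "segment_winding z p (p + d) = axis_winding z (p + d) - axis_winding z p +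
      of_real (between_sign 0 (Re p) (Re z) * between_sign (Im p) (Im (p + d)) (Im z))"
    using 3 by (simp add: segment_winding_step)
  finally show ?case by (simp add: add.assoc)
qed

text \<open>The common value linking both assertions: the integral of \<open>x dy\<close> along a
  path with axis-parallel steps, and the integral of \<open>crossing_sum\<close> over the
  plane.\<close>

fun moment_sum :: "complex \<Rightarrow> complex list \<Rightarrow> real" where
  "moment_sum p [] = 0"
| "moment_sum p (d # ds) = Re p * Im d + moment_sum (p + d) ds"

section \<open>Integration of the winding number over the plane\<close>

lemma has_integral_indicator_box:
  assumes "a \<le> b" "c \<le> d"
  shows "(indicator (box (Complex a c) (Complex b d)) has_integral (b - a) * (d - c)) UNIV"
proof -
  have "measure lebesgue (box (Complex a c) (Complex b d)) = (b - a) * (d - c)"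
    using assms by (simp add: measure_lborel_box_eq Basis_complex_def)
  then show ?thesis
    using lmeasurable_iff_has_integral[of "box (Complex a c) (Complex b d)"] by simp
qed

lemma has_integral_between_sign:
  "((\<lambda>z. between_sign a b (Re z) * between_sign c d (Im z)) has_integral (b - a) * (d - c)) UNIV"
proof -
  have le: "((\<lambda>z. between_sign a b (Re z) * between_sign c d (Im z)) has_integral (b - a) * (d - c)) UNIV"
    if "a \<le> b" "c \<le> d" for a b c d
  proof -
    have "between_sign a b (Re z) * between_sign c d (Im z) =
        indicator (box (Complex a c) (Complex b d)) z" for z
      using that by (auto simp: between_sign_def indicator_def in_box_complex_iff)
    then show ?thesis using has_integral_indicator_box[OF that] by simp
  qed
  consider "a \<le> b" "c \<le> d" | "a \<le> b" "d \<le> c" | "b \<le> a" "c \<le> d" | "b \<le> a" "d \<le> c" by linarith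
  then show ?thesis
  proof cases
    case 1
    then show ?thesis by (rule le)
  next
    case 2
    then show ?thesis
      using has_integral_neg[OF le[of a b d c]] between_sign_swap[of c d] by (simp add: algebra_simps)
  next
    case 3
    then show ?thesis
      using has_integral_neg[OF le[of b a c d]] between_sign_swap[of a b] by (simp add: algebra_simps)
  next
    case 4
    then show ?thesis
      using le[of b a d c] between_sign_swap[of a b] between_sign_swap[of c d] by (simp add: algebra_simps)
  qed
qed

lemma has_integral_crossing_sum:
  "((\<lambda>z. crossing_sum z p ds) has_integral moment_sum p ds) UNIV"
proof (induction ds arbitrary: p)
  case (Cons d ds)
  then show ?case
    using has_integral_add[OF has_integral_between_sign[of 0 "Re p" "Im p" "Im (p + d)"] Cons[of "p + d"]]
    by simp
qed simp

lemma negligible_integer_grid: "negligible integer_grid"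
proof -
  have "negligible {z. Re z = c}" "negligible {z. Im z = c}" for c
    using negligible_hyperplane[of "1::complex" c] negligible_hyperplane[of \<i> c] by simp_all
  then have "negligible (\<Union> (range (\<lambda>k. {z. Re z = real_of_int k}) \<union> range (\<lambda>k. {z. Im z = real_of_int k})))"
    by (intro negligible_countable_Union) auto
  moreover have "integer_grid = \<Union> (range (\<lambda>k. {z. Re z = real_of_int k}) \<union> range (\<lambda>k. {z. Im z = real_of_int k}))"
    by (auto simp: integer_grid_def Ints_def)
  ultimately show ?thesis by (simp only:)
qed

lemma enclosed_area_polygonal_path:
  assumes p: "lattice_point p" and ds: "list_all lattice_step ds"
    and closed: "simple_closed_curve (polygonal_path p ds)"
    and ccw: "counterclockwise (polygonal_path p ds)"
  shows "enclosed_area (polygonal_path p ds) = moment_sum p ds"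
proof -
  let ?g = "polygonal_path p ds"
  let ?I = "inside (path_image ?g)"
  have loop: "sum_list ds = 0" using closed by (simp add: simple_closed_curve_def)
  \<comment> \<open>Off the grid both sides are the winding number: 1 inside by the orientation, 0
    outside.\<close>
  have crossing: "indicator ?I z = crossing_sum z p ds" if "z \<notin> integer_grid" for z
  proof -
    have W: "winding_number ?g z = of_real (crossing_sum z p ds)"
      using winding_number_polygonal_path[OF p ds that] loop by simp
    show ?thesis
    proof (cases "z \<in> ?I")
      case True
      then show ?thesis using ccw W by (auto simp: counterclockwise_def)
    next
      case False
      then have "z \<in> outside (path_image ?g)"
        using polygonal_path_off_grid[OF p ds that] inside_Un_outside[of "path_image ?g"] by blast
      then show ?thesis
        using winding_number_zero_in_outside[of ?g z] W False loop by simp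
    qed
  qed
  have "?I \<in> lmeasurable"
    by (intro lmeasurable_open bounded_inside open_inside)
       (simp_all add: bounded_path_image closed_path_image)
  then have "(indicator ?I has_integral enclosed_area ?g) UNIV"
    by (simp add: enclosed_area_def lmeasurable_iff_has_integral)
  moreover have "(indicator ?I has_integral moment_sum p ds) UNIV"
    by (rule has_integral_spike[OF negligible_integer_grid _ has_integral_crossing_sum])
       (use crossing in auto)
  ultimately show ?thesis by (rule has_integral_unique)
qed

subsection \<open>The line integral\<close>

text \<open>\<open>x dy\<close> is the imaginary part of \<open>x dz\<close>, which makes the calculus of contour integrals
  available.\<close>

lemma has_line_integral_contour:
  assumes "((\<lambda>z. of_real (Re z)) has_contour_integral I) g"
  shows "has_line_integral (\<lambda>z. 0) (\<lambda>z. Re z) (Im I) g"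
  using has_integral_Im[OF assms[unfolded has_contour_integral_def]]
  by (simp add: has_line_integral_def)

text \<open>\<open>Re\<close> is affine along the segment, so its mean is the value at the
  midpoint.\<close>

lemma has_contour_integral_Re_linepath:
  "((\<lambda>z. of_real (Re z)) has_contour_integral of_real (Re p + Re d / 2) * d) (linepath p (p + d))"
proof -
  have "((\<lambda>t. Re p + t * Re d) has_integral (Re p + Re d / 2)) {0..1}"
  proof -
    have "((\<lambda>t. Re p + t * Re d) has_integral
        (Re p * 1 + 1\<^sup>2 / 2 * Re d) - (Re p * 0 + 0\<^sup>2 / 2 * Re d)) {0..1}"
      by (rule fundamental_theorem_of_calculus)
         (auto intro!: derivative_eq_intros simp flip: has_real_derivative_iff_has_vector_derivative)
    then show ?thesis by simp
  qed
  then have "((\<lambda>t. of_real (Re p + t * Re d) * d) has_integral of_real (Re p + Re d / 2) * d) {0..1}"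
    by (intro has_integral_mult_left has_integral_of_real)
  then show ?thesis
    unfolding has_contour_integral_linepath by (simp add: linepath_def algebra_simps)
qed

text \<open>Only the imaginary part of the integral matters, so \<open>I\<close> is left
  existential; validity of the path is carried along because joining contour integrals requires
  it.\<close>

lemma has_contour_integral_Re_polygonal_path:
  assumes "list_all lattice_step ds"
  shows "\<exists>I. ((\<lambda>z. of_real (Re z)) has_contour_integral I) (polygonal_path p ds) \<and> Im I = moment_sum p ds
    \<and> valid_path (polygonal_path p ds)"
  using assms
proof (induction p ds rule: polygonal_path.induct)
  case (1 p)
  then show ?case
    unfolding polygonal_path.simps
    by (intro exI[of _ 0] conjI valid_path_linepath) (simp_all only: has_contour_integral_trivial moment_sum.simps zero_complex.sel)
next
  case (2 p d)
  then show ?case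
    by (intro exI[of _ "of_real (Re p + Re d / 2) * d"])
       (use has_contour_integral_Re_linepath[of p d] in \<open>auto simp: lattice_step_def\<close>)
next
  case (3 p d d' ds)
  then obtain I where I: "((\<lambda>z. of_real (Re z)) has_contour_integral I) (polygonal_path (p + d) (d' # ds))"
    "Im I = moment_sum (p + d) (d' # ds)" "valid_path (polygonal_path (p + d) (d' # ds))"
    by auto
  have "((\<lambda>z. of_real (Re z)) has_contour_integral of_real (Re p + Re d / 2) * d + I)
      (polygonal_path p (d # d' # ds))"
    using has_contour_integral_join[OF has_contour_integral_Re_linepath I(1) valid_path_linepath I(3)] by simp
  \<comment> \<open>The midpoint correction \<open>Re d * Im d / 2\<close> vanishes because the step
    is axis-parallel.\<close>
  moreover have "Im (of_real (Re p + Re d / 2) * d + I) = moment_sum p (d # d' # ds)"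
    using I(2) 3 by (auto simp: lattice_step_def)
  moreover have "valid_path (polygonal_path p (d # d' # ds))"
    using I(3) by (simp add: valid_path_join)
  ultimately show ?case by blast
qed

subsection \<open>The word invariant as a sum over the vertical edges\<close>

abbreviation steps :: "nat \<Rightarrow> nat \<Rightarrow> word \<Rightarrow> complex list" where
  "steps i j w \<equiv> map (letter_move i) (filter (\<lambda>l. fst l \<in> {i, j}) w)"

lemma steps_lattice: "is_word n w \<Longrightarrow> list_all lattice_step (steps i j w)"
  by (auto simp: list_all_iff letter_move_def lattice_step_def lattice_point_def)

text \<open>\<open>moment_sum\<close> recurses from the front, whereas \<open>e\<close> grows by one
  outer summand when a letter is appended; this form lets the two be compared by reverse
  induction.\<close>

lemma moment_sum_snoc:
  "moment_sum p (ds @ [d]) = moment_sum p ds + Re (p + sum_list ds) * Im d"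
  by (induction ds arbitrary: p) (auto simp: algebra_simps)

lemma letter_append [simp]:
  assumes "v \<in> {1..length w}"
  shows "letter_index (w @ w') v = letter_index w v" "letter_sign (w @ w') v = letter_sign w v"
  using assms by (auto simp: letter_index_def letter_sign_def nth_append)

lemma letter_last [simp]:
  "letter_index (w @ [l]) (Suc (length w)) = fst l" "letter_sign (w @ [l]) (Suc (length w)) = snd l"
  by (simp_all add: letter_index_def letter_sign_def)

lemma Re_sum_list_steps:
  assumes "i \<noteq> j"
  shows "Re (sum_list (steps i j w)) =
    of_int (\<Sum>u = 1..length w. kronecker (letter_index w u) i * letter_sign w u)"
proof (induction w rule: rev_induct)
  case (snoc l w)
  have "(\<Sum>u = 1..length w. kronecker (letter_index (w @ [l]) u) i * letter_sign (w @ [l]) u) =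
      (\<Sum>u = 1..length w. kronecker (letter_index w u) i * letter_sign w u)"
    by (intro sum.cong) auto
  then show ?case
    using snoc by (cases l) (auto simp: letter_move_def kronecker_def)
qed simp

text \<open>An appended \<open>j\<close>-letter adds its sign times the signed count of earlier
  \<open>i\<close>-letters, and that count is the abscissa at which its vertical edge is
  drawn.\<close>

lemma e_eq_moment_sum:
  assumes "i \<noteq> j"
  shows "real_of_int (e i j w) = moment_sum 0 (steps i j w)"
proof (induction w rule: rev_induct)
  case Nil
  then show ?case by (simp add: e_def)
next
  case (snoc l w)
  let ?X = "\<Sum>u = 1..length w. kronecker (letter_index w u) i * letter_sign w u"
  let ?t = "\<lambda>w u v. kronecker (letter_index w u) i * kronecker (letter_index w v) j *
     letter_sign w u * letter_sign w v"
  have "(\<Sum>v = 1..length w. \<Sum>u = 1..v. ?t (w @ [l]) u v) = e i j w"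
    unfolding e_def by (intro sum.cong refl) auto
  moreover have "(\<Sum>u = 1..length w. ?t (w @ [l]) u (Suc (length w))) =
      ?X * (kronecker (fst l) j * snd l)"
    unfolding sum_distrib_right by (intro sum.cong refl) (auto simp: algebra_simps)
  \<comment> \<open>The diagonal term \<open>u = v\<close> vanishes, since one letter cannot have
    both indices \<open>i\<close> and \<open>j\<close>; hence only strictly earlier letters
    count.\<close>
  moreover have "?t (w @ [l]) (Suc (length w)) (Suc (length w)) = 0"
    using assms by (simp add: kronecker_def)
  ultimately have e: "e i j (w @ [l]) = e i j w + ?X * (kronecker (fst l) j * snd l)"
    unfolding e_def by simp
  show ?case
    unfolding e using snoc assms Re_sum_list_steps[OF assms, of w]
    by (cases l) (auto simp: moment_sum_snoc letter_move_def kronecker_def)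
qed

theorem theorem7:
  fixes n i j :: nat and w :: word
  assumes "is_word n w"
    and "i \<in> {1..n}" and "j \<in> {1..n}" and "i \<noteq> j"
  shows "has_line_integral (\<lambda>z. 0) (\<lambda>z. Re z) (real_of_int (e i j w)) (curve i j w) \<and>
    (simple_closed_curve (curve i j w) \<and> counterclockwise (curve i j w) \<longrightarrow>
       real_of_int (e i j w) = enclosed_area (curve i j w))"
proof -
  have lattice: "list_all lattice_step (steps i j w)"
    using assms(1) by (rule steps_lattice)
  obtain I where "((\<lambda>z. of_real (Re z)) has_contour_integral I) (curve i j w)"
    "Im I = real_of_int (e i j w)"
    using has_contour_integral_Re_polygonal_path[OF lattice, of 0]
    unfolding curve_def e_eq_moment_sum[OF assms(4)] by blast
  then have "has_line_integral (\<lambda>z. 0) (\<lambda>z. Re z) (real_of_int (e i j w)) (curve i j w)"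
    using has_line_integral_contour by metis
  moreover have "enclosed_area (curve i j w) = real_of_int (e i j w)"
    if "simple_closed_curve (curve i j w)" "counterclockwise (curve i j w)"
    using enclosed_area_polygonal_path[OF _ lattice, of 0] that
    unfolding curve_def e_eq_moment_sum[OF assms(4)] by (simp add: lattice_point_def)
  ultimately show ?thesis by simp
qed

end
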